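(* Let $P=[2]\times[n]$ with $n$ odd. Let $\mathcal{O}$ be a rowmotion orbit of size $n+3$ containing one of the following ICS: (1) $[0,r,n-r:0,r-1,n+1-r]$ with $1\le r\le n/2$; (2) $[b,i,a:b,i,a]$ with $a,i,b>0$, $a+i+b=n$, not $a=i=b=n/3$; (3) $[b,i,0:b-t,t+i,0]$ with $b+i=n$, $i\ge1$, $t\ge2$, $b-t\ge1$; (4) $[b,k+j,a:0,b+k,a+j]$ with $a+b+j+k=n$, $j\ge2$, $b\ge2$, $k\ge1$, $a\ge0$, and ($j\ne b$ or $a+1\ne k$). Then the average value of signed cardinality over $\mathcal{O}$ is $0$.
   Context: $[2]\times[n]=\{(i,j): i\in\{1,2\},1\le j\le n\}$ with the componentwise order. An interval-closed set (ICS) is a subset $I$ with $x,y\in I$, $x\le z\le y\Rightarrow z\in I$. The toggle $t_x$ sends $I$ to $I\triangle\{x\}$ if this is an ICS, and to $I$ otherwise; rowmotion is $\mathrm{Row}=t_{x_1}\circ\cdots\circ t_{x_N}$ for any linear extension $x_1,\dots,x_N$ (toggles applied top to bottom). For nonnegative integers with $b_1+i_1+a_1=b_2+i_2+a_2=n$, $[b_1,i_1,a_1:b_2,i_2,a_2]$ denotes $\{(1,j): b_1<j\le b_1+i_1\}\cup\{(2,j): b_2<j\le b_2+i_2\}$. The rank of $(i,j)$ is $i+j-2$; $\mathrm{sc}(x)=(-1)^{\mathrm{rank}(x)}$ and $\mathrm{sc}(I)=\sum_{x\in I}\mathrm{sc}(x)$. The average over $\mathcal{O}$ is $\frac1{|\mathcal{O}|}\sum_{I\in\mathcal{O}}\mathrm{sc}(I)$.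 *)

theory Defs
  imports Complex_Main "HOL-Library.Product_Order" "HOL-Combinatorics.Orbits"
begin

text \<open>A finite poset is given by a finite carrier \<open>P\<close> inside a partially ordered type.\<close>

definition interval_closed :: "'a::order set \<Rightarrow> 'a set \<Rightarrow> bool" where
  "interval_closed P I \<longleftrightarrow>
     I \<subseteq> P \<and> (\<forall>x\<in>I. \<forall>y\<in>I. \<forall>z\<in>P. x \<le> z \<and> z \<le> y \<longrightarrow> z \<in> I)"

definition toggle :: "'a::order set \<Rightarrow> 'a \<Rightarrow> 'a set \<Rightarrow> 'a set" where
  "toggle P x I =
     (if interval_closed P (sym_diff I {x}) then sym_diff I {x} else I)"

definition linear_extension :: "'a::order set \<Rightarrow> 'a list \<Rightarrow> bool" where
  "linear_extension P xs \<longleftrightarrow>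
     distinct xs \<and> set xs = P \<and>
     (\<forall>i<length xs. \<forall>j<length xs. xs ! i \<le> xs ! j \<longrightarrow> i \<le> j)"

text \<open>The right fold makes this the composition of the toggles at \<open>x\<^sub>1, \<dots>, x\<^sub>N\<close> in that
  order, so the toggle at the last (top) element acts first.\<close>

definition rowmotion :: "'a::order set \<Rightarrow> 'a list \<Rightarrow> 'a set \<Rightarrow> 'a set" where
  "rowmotion P xs = foldr (toggle P) xs"

text \<open>\<^const>\<open>cyclic_on\<close> uses strictly positive iterates only. This gives the usual orbits, because
  rowmotion permutes the finite set of interval-closed sets.\<close>

definition rowmotion_orbit :: "'a::order set \<Rightarrow> 'a list \<Rightarrow> 'a set set \<Rightarrow> bool" where
  "rowmotion_orbit P xs \<O> \<longleftrightarrow>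
     (\<forall>I\<in>\<O>. interval_closed P I) \<and> cyclic_on (rowmotion P xs) \<O>"

text \<open>On pairs, \<open>\<le>\<close> is the componentwise order of \<^theory>\<open>HOL-Library.Product_Order\<close>.\<close>

definition two_by :: "nat \<Rightarrow> (nat \<times> nat) set" where
  "two_by n = {1..2} \<times> {1..n}"

text \<open>The set written \<open>[b\<^sub>1, i\<^sub>1, a\<^sub>1 : b\<^sub>2, i\<^sub>2, a\<^sub>2]\<close>. The numbers \<open>a\<^sub>1\<close>, \<open>a\<^sub>2\<close> of elements above
  are determined by \<open>b\<^sub>k + i\<^sub>k + a\<^sub>k = n\<close>; they are kept as arguments only to follow the notation.\<close>

definition two_row_set ::
    "nat \<Rightarrow> nat \<Rightarrow> nat \<Rightarrow> nat \<Rightarrow> nat \<Rightarrow> nat \<Rightarrow> (nat \<times> nat) set" where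
  "two_row_set b1 i1 a1 b2 i2 a2 =
     {(1, j) | j. b1 < j \<and> j \<le> b1 + i1} \<union> {(2, j) | j. b2 < j \<and> j \<le> b2 + i2}"

definition grid_rank :: "nat \<times> nat \<Rightarrow> nat" where
  "grid_rank x = fst x + snd x - 2"

definition signed_card :: "(nat \<times> nat) set \<Rightarrow> int" where
  "signed_card I = (\<Sum>x\<in>I. (- 1) ^ grid_rank x)"

definition average_signed_card :: "(nat \<times> nat) set set \<Rightarrow> real" where
  "average_signed_card \<O> = (\<Sum>I\<in>\<O>. real_of_int (signed_card I)) / real (card \<O>)"

end

theory Submission
  imports Defs
begin

text \<open>
  An interval-closed set of \<open>[2] \<times> [n]\<close> is a pair of intervals, one per row. Write \<open>e x = (-1)^x\<close>.
  If the row intervals are \<open>[l\<^sub>1, r\<^sub>1]\<close> and \<open>[l\<^sub>2, r\<^sub>2]\<close>, then \<open>2 sc = e l\<^sub>2 + e r\<^sub>2 - e l\<^sub>1 - e r\<^sub>1\<close>.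
  A typical rowmotion step shifts both intervals by one to the right and so flips the sign of \<open>sc\<close>.
  Hence \<open>sc I + sc (Row I)\<close> vanishes except at the few steps where an interval hits a wall or the other
  interval, and there it is \<open>(K (Row I) - K I) / 2\<close> for a potential \<open>K\<close> read off from the endpoints.
  Summing over the orbit, the left side gives twice the total signed cardinality and the right
  side telescopes to \<open>0\<close>.

  The four families of the theorem lie in three rowmotion-invariant sets of endpoint data, and each
  has its own \<open>K\<close>. Cases (3), (4) and (1) with \<open>r \<ge> 2\<close> are generic, case (2) is the
  orbit through three sets with two equal rows, and case (1) with \<open>r = 1\<close> is a single orbit, the
  only one among these that meets sets with an empty row.
\<close>

section \<open>Toggles and rowmotion on a finite poset\<close>

lemma toggle_other: "y \<noteq> x \<Longrightarrow> y \<in> toggle P x S \<longleftrightarrow> y \<in> S"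
  by (auto simp: toggle_def)

lemma interval_closed_toggle: "interval_closed P S \<Longrightarrow> interval_closed P (toggle P x S)"
  by (simp add: toggle_def)

lemma interval_closedD:
  "interval_closed P S \<Longrightarrow> u \<in> S \<Longrightarrow> v \<in> S \<Longrightarrow> z \<in> P \<Longrightarrow> u \<le> z \<Longrightarrow> z \<le> v \<Longrightarrow> z \<in> S"
  unfolding interval_closed_def by blast

text \<open>Phrasing the criterion through elements strictly below and strictly above
  \<open>x\<close> is what lets \<open>rowmotion_eqI\<close> replace the current set by the initial
  one below \<open>x\<close> and by the final one above.\<close>

lemma mem_toggle_iff:
  assumes S: "interval_closed P S" and x: "x \<in> P"
  shows "x \<in> toggle P x S \<longleftrightarrow>
    (if x \<in> S then (\<exists>u\<in>S. u < x) \<and> (\<exists>v\<in>S. x < v)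
     else (\<forall>v\<in>S. \<forall>z\<in>P. x < z \<and> z < v \<longrightarrow> z \<in> S) \<and> (\<forall>u\<in>S. \<forall>z\<in>P. u < z \<and> z < x \<longrightarrow> z \<in> S))"
proof (cases "x \<in> S")
  case True
  then have eq: "sym_diff S {x} = S - {x}" by blast
  have "interval_closed P (S - {x}) \<longleftrightarrow> \<not> ((\<exists>u\<in>S. u < x) \<and> (\<exists>v\<in>S. x < v))"
  proof
    assume "interval_closed P (S - {x})"
    then have "\<not> (u < x \<and> x < v)" if "u \<in> S" "v \<in> S" for u v
      using interval_closedD[of P "S - {x}" u v x] that x
      by (auto simp: less_le)
    then show "\<not> ((\<exists>u\<in>S. u < x) \<and> (\<exists>v\<in>S. x < v))" by blast
  next
    assume *: "\<not> ((\<exists>u\<in>S. u < x) \<and> (\<exists>v\<in>S. x < v))"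
    show "interval_closed P (S - {x})"
      unfolding interval_closed_def
    proof (intro conjI ballI impI)
      show "S - {x} \<subseteq> P" using S by (auto simp: interval_closed_def)
      fix u v z assume a: "u \<in> S - {x}" "v \<in> S - {x}" "z \<in> P" "u \<le> z \<and> z \<le> v"
      then have "z \<in> S" using interval_closedD[OF S] by blast
      moreover have "z \<noteq> x" using a * by (auto simp: order_less_le)
      ultimately show "z \<in> S - {x}" by blast
    qed
  qed
  then show ?thesis using True by (simp add: toggle_def eq)
next
  case False
  then have eq: "sym_diff S {x} = insert x S" by blast
  have "interval_closed P (insert x S) \<longleftrightarrow> (\<forall>v\<in>S. \<forall>z\<in>P. x < z \<and> z < v \<longrightarrow> z \<in> S) \<and>
     (\<forall>u\<in>S. \<forall>z\<in>P. u < z \<and> z < x \<longrightarrow> z \<in> S)" (is "_ \<longleftrightarrow> ?R")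
  proof
    assume "interval_closed P (insert x S)"
    then have *: "z \<in> insert x S" if "u \<in> insert x S" "v \<in> insert x S" "z \<in> P" "u < z" "z < v" for u v z
      using interval_closedD[of P "insert x S" u v z] that by simp
    show ?R
    proof (intro conjI ballI impI)
      show "z \<in> S" if "v \<in> S" "z \<in> P" "x < z \<and> z < v" for v z
        using *[of x v z] that by auto
      show "z \<in> S" if "u \<in> S" "z \<in> P" "u < z \<and> z < x" for u z
        using *[of u x z] that by auto
    qed
  next
    assume *: ?R
    show "interval_closed P (insert x S)"
      unfolding interval_closed_def
    proof (intro conjI ballI impI)
      show "insert x S \<subseteq> P" using S x by (auto simp: interval_closed_def)
      fix u v z assume a: "u \<in> insert x S" "v \<in> insert x S" "z \<in> P" "u \<le> z \<and> z \<le> v"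
      show "z \<in> insert x S"
      proof (cases "z = u \<or> z = v")
        case False
        then have less: "u < z" "z < v" using a(4) by auto
        then have "\<not> (u = x \<and> v = x)" using less_asym by metis
        then consider "u \<in> S" "v \<in> S" | "u = x" "v \<in> S" | "u \<in> S" "v = x"
          using a(1,2) by blast
        then show ?thesis
        proof cases
          case 1
          then show ?thesis using interval_closedD[OF S 1 a(3)] a(4) by blast
        next
          case 2
          then show ?thesis using conjunct1[OF *, rule_format, of v z] a(3) less by simp
        next
          case 3
          then show ?thesis using conjunct2[OF *, rule_format, of u z] a(3) less by simp
        qed
      qed (use a in auto)
    qed
  qed
  moreover have "x \<in> toggle P x S \<longleftrightarrow> interval_closed P (insert x S)"
    using False by (simp add: toggle_def eq)
  ultimately show ?thesis using False by (simp only: if_False)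
qed

text \<open>When \<open>x\<close> is toggled, everything above it already has its final value and everything
  below it still has its initial one. Whether the toggle acts depends only on the elements
  comparable to \<open>x\<close>, so the linear extension does not matter.\<close>

lemma rowmotion_eqI:
  assumes xs: "linear_extension P xs" and I: "interval_closed P I" and J: "J \<subseteq> P"
    and local: "\<And>x. x \<in> P \<Longrightarrow> x \<in> J \<longleftrightarrow>
      (if x \<in> I then (\<exists>u\<in>I. u < x) \<and> (\<exists>v\<in>J. x < v)
       else (\<forall>v\<in>J. \<forall>z\<in>P. x < z \<and> z < v \<longrightarrow> z \<in> J) \<and> (\<forall>u\<in>I. \<forall>z\<in>P. u < z \<and> z < x \<longrightarrow> z \<in> I))"
  shows "rowmotion P xs I = J"
proof -
  have dist: "distinct xs" and P: "set xs = P"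
    and ext: "\<And>i j. i < length xs \<Longrightarrow> j < length xs \<Longrightarrow> xs ! i \<le> xs ! j \<Longrightarrow> i \<le> j"
    using xs unfolding linear_extension_def by simp_all
  \<comment> \<open>Since \<open>foldr\<close> applies the toggles of the suffix \<open>zs\<close>
    first, the current set agrees with \<open>J\<close> on \<open>zs\<close> and with
    \<open>I\<close> elsewhere. Thus a candidate \<open>J\<close> is only verified, never
    computed.\<close>
  have main: "interval_closed P (foldr (toggle P) zs I) \<and>
      (\<forall>y. y \<in> foldr (toggle P) zs I \<longleftrightarrow> (if y \<in> set zs then y \<in> J else y \<in> I))"
    if "xs = ys @ zs" for ys zs
    using that
  proof (induction zs arbitrary: ys)
    case Nil
    then show ?case using I by simp
  next
    case (Cons x zs)
    define S where "S = foldr (toggle P) zs I"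
    have S: "interval_closed P S" and mem: "\<And>y. y \<in> S \<longleftrightarrow> (if y \<in> set zs then y \<in> J else y \<in> I)"
      using Cons.IH[of "ys @ [x]"] Cons.prems by (auto simp: S_def)
    have x: "x \<in> P" and xzs: "x \<notin> set zs"
      using P dist Cons.prems by auto
    have xs_x: "length ys < length xs" "xs ! length ys = x"
      using Cons.prems by auto
    have pos: "\<exists>i<length xs. xs ! i = y" if "y \<in> P" for y
      using that P by (auto simp: in_set_conv_nth)
    have above: "y \<in> set zs" if "y \<in> P" "x < y" for y
    proof -
      obtain i where i: "i < length xs" "xs ! i = y" using pos[OF \<open>y \<in> P\<close>] by blast
      then have "length ys \<le> i"
        using ext[of "length ys" i] xs_x that by simp
      moreover have "i \<noteq> length ys" using i that xs_x by auto
      ultimately have "i - length ys - 1 < length zs" "zs ! (i - length ys - 1) = y"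
        using i Cons.prems by (auto simp: nth_append)
      then show ?thesis by (metis nth_mem)
    qed
    have below: "y \<notin> set zs" if "y < x" for y
    proof
      assume "y \<in> set zs"
      then obtain k where k: "k < length zs" "zs ! k = y" by (auto simp: in_set_conv_nth)
      then have "xs ! (length ys + Suc k) = y" "length ys + Suc k < length xs"
        using Cons.prems by (auto simp: nth_append)
      then have "length ys + Suc k \<le> length ys"
        using ext[of "length ys + Suc k" "length ys"] xs_x less_imp_le[OF that] by simp
      then show False by simp
    qed
    have SP: "S \<subseteq> P" "I \<subseteq> P" using S I by (auto simp: interval_closed_def)
    have up: "y \<in> S \<longleftrightarrow> y \<in> J" if "x < y" for y
      using above[OF _ that] mem[of y] SP J by auto
    have down: "y \<in> S \<longleftrightarrow> y \<in> I" if "y < x" for y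
      using below that mem by simp
    have "x \<in> toggle P x S \<longleftrightarrow> x \<in> J"
    proof -
      have 1: "(\<exists>u\<in>S. u < x) \<longleftrightarrow> (\<exists>u\<in>I. u < x)" "(\<exists>v\<in>S. x < v) \<longleftrightarrow> (\<exists>v\<in>J. x < v)"
        using up down by blast+
      have up2: "v \<in> S \<longleftrightarrow> v \<in> J" if "x < z" "z < v" for z v
        using that by (meson up less_trans)
      have down2: "u \<in> S \<longleftrightarrow> u \<in> I" if "u < z" "z < x" for z u
        using that by (meson down less_trans)
      have 2: "(\<forall>v\<in>S. \<forall>z\<in>P. x < z \<and> z < v \<longrightarrow> z \<in> S) \<longleftrightarrow>
          (\<forall>v\<in>J. \<forall>z\<in>P. x < z \<and> z < v \<longrightarrow> z \<in> J)"
        using up up2 by blast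
      have 3: "(\<forall>u\<in>S. \<forall>z\<in>P. u < z \<and> z < x \<longrightarrow> z \<in> S) \<longleftrightarrow>
          (\<forall>u\<in>I. \<forall>z\<in>P. u < z \<and> z < x \<longrightarrow> z \<in> I)"
        using down down2 by blast
      have 4: "x \<in> S \<longleftrightarrow> x \<in> I" using mem xzs by simp
      show ?thesis unfolding mem_toggle_iff[OF S x] local[OF x] 1 2 3 4 ..
    qed
    then have "y \<in> toggle P x S \<longleftrightarrow> (if y \<in> set (x # zs) then y \<in> J else y \<in> I)" for y
      using mem[of y] by (cases "y = x") (auto simp: toggle_other)
    then show ?case
      using interval_closed_toggle[OF S] by (simp add: S_def)
  qed
  have "y \<in> foldr (toggle P) xs I \<longleftrightarrow> y \<in> J" for y
    using main[of "[]" xs] P I J unfolding interval_closed_def by auto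
  then show ?thesis by (auto simp: rowmotion_def)
qed

section \<open>Telescoping over a finite orbit\<close>

text \<open>As \<open>f\<close> permutes the finite set \<open>A\<close>, the potential differences
  cancel and \<open>s\<close> has the same sum before and after \<open>f\<close>, so twice that sum
  is 0. Injectivity of \<open>enc\<close> turns \<open>K\<close>, a function of states, into a
  function on \<open>A\<close>.\<close>

lemma orbit_sum_eq_0:
  fixes s :: "'a \<Rightarrow> int" and K :: "'b \<Rightarrow> int"
  assumes cyc: "cyclic_on f A" and inj: "inj_on enc T"
    and start: "t0 \<in> T" "enc t0 \<in> A"
    and step: "\<And>t. t \<in> T \<Longrightarrow> enc t \<in> A \<Longrightarrow>
      \<exists>t'\<in>T. f (enc t) = enc t' \<and> s (enc t) + s (enc t') = K t' - K t"
  shows "sum s A = 0"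
proof -
  have A: "A = orbit f (enc t0)"
    using cyc start(2) by (simp add: cyclic_on_alldef)
  have "a \<in> enc ` T" if "a \<in> orbit f (enc t0)" for a
    using that
  proof (induction rule: orbit.induct)
    case base
    then show ?case using step start by blast
  next
    case (step a)
    \<comment> \<open>The induction case shadows the name \<open>step\<close>;
      \<open>assms(5)\<close> is the hypothesis of that name.\<close>
    then show ?case using assms(5) A by blast
  qed
  then have encA: "\<exists>t\<in>T. a = enc t" if "a \<in> A" for a using that A by blast
  have fA: "f a \<in> A" if "a \<in> A" for a using that A by (metis orbit.step)
  \<comment> \<open>An orbit consists of strictly positive iterates, so every element,
    \<open>enc t0\<close> included, is an image under \<open>f\<close>.\<close>
  have "A \<subseteq> f ` A"
  proof
    fix a assume "a \<in> A"
    then have "a \<in> orbit f (enc t0)" using A by simp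
    then show "a \<in> f ` A" using start(2) A by cases auto
  qed
  then have img: "f ` A = A" using fA by blast
  then have injf: "inj_on f A" using finite_cyclic_on[OF cyc] by (simp add: eq_card_imp_inj_on)
  define k where "k = K \<circ> the_inv_into T enc"
  have reindex: "(\<Sum>a\<in>A. g (f a)) = sum g A" for g :: "'a \<Rightarrow> int"
    using sum.reindex[OF injf, of g] img by simp
  have "s a + s (f a) = k (f a) - k a" if "a \<in> A" for a
  proof -
    obtain t where t: "t \<in> T" "a = enc t" using encA[OF \<open>a \<in> A\<close>] by blast
    then obtain t' where "t' \<in> T" "f a = enc t'" "s a + s (f a) = K t' - K t"
      using step[of t] \<open>a \<in> A\<close> by auto
    with t show ?thesis by (simp add: k_def the_inv_into_f_f[OF inj])
  qed
  then have "(\<Sum>a\<in>A. s a + s (f a)) = (\<Sum>a\<in>A. k (f a) - k a)" by simp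
  then show ?thesis by (simp add: sum.distrib sum_subtractf reindex)
qed

section \<open>Rowmotion on pairs of row intervals\<close>

text \<open>An empty row has many encodings, and the transition rules below need one with \<open>l = r + 1\<close>
  that fits the other row: \<open>l\<^sub>1 = n + 1\<close> if row 1 is empty, \<open>l\<^sub>2 = l\<^sub>1\<close> if row 2 is empty.\<close>

definition rows :: "nat \<Rightarrow> nat \<Rightarrow> nat \<Rightarrow> nat \<Rightarrow> (nat \<times> nat) set" where
  "rows l1 r1 l2 r2 = {1} \<times> {l1..r1} \<union> {2} \<times> {l2..r2}"

lemma mem_rows: "(i, j) \<in> rows l1 r1 l2 r2 \<longleftrightarrow> i = 1 \<and> l1 \<le> j \<and> j \<le> r1 \<or> i = 2 \<and> l2 \<le> j \<and> j \<le> r2"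
  by (auto simp: rows_def)

lemma ball_rows:
  "(\<forall>x\<in>rows l1 r1 l2 r2. Q x) \<longleftrightarrow> (\<forall>j\<in>{l1..r1}. Q (1, j)) \<and> (\<forall>j\<in>{l2..r2}. Q (2, j))"
  by (auto simp: rows_def)

lemma bex_rows:
  "(\<exists>x\<in>rows l1 r1 l2 r2. Q x) \<longleftrightarrow> (\<exists>j\<in>{l1..r1}. Q (1, j)) \<or> (\<exists>j\<in>{l2..r2}. Q (2, j))"
  by (auto simp: rows_def)

lemma ball_two_by:
  "(\<forall>x\<in>two_by n. Q x) \<longleftrightarrow> (\<forall>j\<in>{1..n}. Q (1, j)) \<and> (\<forall>j\<in>{1..n}. Q (2, j))"
proof -
  have "{1..2::nat} = {1, 2}" by auto
  then show ?thesis by (auto simp: two_by_def)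
qed

lemma less_pair_iff:
  fixes b d :: nat
  shows "(1 :: nat, b) < (1, d) \<longleftrightarrow> b < d" "(2 :: nat, b) < (2, d) \<longleftrightarrow> b < d"
    "(1 :: nat, b) < (2, d) \<longleftrightarrow> b \<le> d" "(2 :: nat, b) < (1, d) \<longleftrightarrow> False"
  by (auto simp: less_prod_def)

text \<open>The conditions \<open>row1\<close> and \<open>row2\<close> are the local condition of \<open>rowmotion_eqI\<close> after
  quantifier elimination, so that each transition rule becomes linear arithmetic.\<close>

lemma rowmotion_rowsI:
  assumes xs: "linear_extension (two_by n) xs"
    and I: "interval_closed (two_by n) (rows l1 r1 l2 r2)"
    and bounds: "1 \<le> l1" "r1 \<le> n" "1 \<le> l2" "r2 \<le> n" "1 \<le> m1" "s1 \<le> n" "1 \<le> m2" "s2 \<le> n"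
    and row2: "\<And>j. 1 \<le> j \<Longrightarrow> j \<le> n \<Longrightarrow> m2 \<le> j \<and> j \<le> s2 \<longleftrightarrow>
      (if l2 \<le> j \<and> j \<le> r2 then (l2 < j \<or> l1 \<le> j \<and> l1 \<le> r1) \<and> j < s2 \<and> m2 \<le> s2
       else (s2 \<le> j \<or> m2 \<le> j + 1 \<or> s2 < m2) \<and> (j \<le> l2 \<or> j \<le> r2 + 1 \<or> r2 < l2) \<and>
         (j < l1 \<or> r1 < l1 \<or> j \<le> r1 \<and> (l1 < j \<longrightarrow> l2 \<le> l1 \<and> j \<le> r2 + 1)))"
    and row1: "\<And>j. 1 \<le> j \<Longrightarrow> j \<le> n \<Longrightarrow> m1 \<le> j \<and> j \<le> s1 \<longleftrightarrow>
      (if l1 \<le> j \<and> j \<le> r1 then l1 < j \<and> (j < s1 \<and> m1 \<le> s1 \<or> j \<le> s2 \<and> m2 \<le> s2)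
       else (s1 \<le> j \<or> m1 \<le> j + 1 \<or> s1 < m1) \<and> (j \<le> l1 \<or> j \<le> r1 + 1 \<or> r1 < l1) \<and>
         (s2 < j \<or> s2 < m2 \<or> m2 \<le> j \<and> (j < s2 \<longrightarrow> m1 \<le> j + 1 \<and> s2 \<le> s1)))"
  shows "rowmotion (two_by n) xs (rows l1 r1 l2 r2) = rows m1 s1 m2 s2"
proof (rule rowmotion_eqI[OF xs I])
  show "rows m1 s1 m2 s2 \<subseteq> two_by n"
    using bounds by (auto simp: rows_def two_by_def)
  have quant: "(\<exists>k\<in>{l..r}. k < j) \<longleftrightarrow> l \<le> r \<and> l < j" "(\<exists>k\<in>{l..r}. k \<le> j) \<longleftrightarrow> l \<le> r \<and> l \<le> j"
    "(\<exists>k\<in>{l..r}. j < k) \<longleftrightarrow> l \<le> r \<and> j < r" "(\<exists>k\<in>{l..r}. j \<le> k) \<longleftrightarrow> l \<le> r \<and> j \<le> r"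
    for l r j :: nat
    by force+
  \<comment> \<open>Only one extreme pair matters: the far end of the interval as \<open>k\<close>,
    and as \<open>z\<close> the neighbour of \<open>j\<close> on that side.\<close>
  have between: "(\<forall>k\<in>{l..r}. \<forall>z\<in>{1..n}. j < z \<and> z < k \<longrightarrow> l \<le> z \<and> z \<le> r) \<longleftrightarrow> r \<le> j \<or> l \<le> j + 1 \<or> r < l"
    "(\<forall>k\<in>{l..r}. \<forall>z\<in>{1..n}. k < z \<and> z < j \<longrightarrow> l \<le> z \<and> z \<le> r) \<longleftrightarrow> j \<le> l \<or> j \<le> r + 1 \<or> r < l"
    if "1 \<le> j" "j \<le> n" "r \<le> n" "1 \<le> l" for l r j :: nat
  proof -
    show "(\<forall>k\<in>{l..r}. \<forall>z\<in>{1..n}. j < z \<and> z < k \<longrightarrow> l \<le> z \<and> z \<le> r) \<longleftrightarrow> r \<le> j \<or> l \<le> j + 1 \<or> r < l"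
      (is "?L \<longleftrightarrow> ?R")
    proof
      assume L: ?L
      show ?R
        using L[rule_format, of r "j + 1"] that by (cases "j + 1 < r") auto
    qed auto
    show "(\<forall>k\<in>{l..r}. \<forall>z\<in>{1..n}. k < z \<and> z < j \<longrightarrow> l \<le> z \<and> z \<le> r) \<longleftrightarrow> j \<le> l \<or> j \<le> r + 1 \<or> r < l"
      (is "?L \<longleftrightarrow> ?R")
    proof
      assume L: ?L
      show ?R
        using L[rule_format, of l "j - 1"] that by (cases j; cases "l + 1 < j") auto
    qed auto
  qed
  \<comment> \<open>Strictly between \<open>(1, j)\<close> and \<open>(2, k)\<close> lie the
    \<open>(1, z)\<close> with \<open>j < z <= k\<close> and the \<open>(2, z)\<close> with
    \<open>j <= z < k\<close>. The binding \<open>k\<close> is \<open>s2\<close>; there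
    \<open>z = j\<close>, \<open>z = j + 1\<close> and \<open>z = s2\<close> give the three bounds
    on the right.\<close>
  have across_up: "(\<forall>k\<in>{m2..s2}. \<forall>z\<in>{1..n}. (j < z \<and> z \<le> k \<longrightarrow> m1 \<le> z \<and> z \<le> s1) \<and> (j \<le> z \<and> z < k \<longrightarrow> m2 \<le> z \<and> z \<le> s2)) \<longleftrightarrow>
     (s2 < j \<or> s2 < m2 \<or> m2 \<le> j \<and> (j < s2 \<longrightarrow> m1 \<le> j + 1 \<and> s2 \<le> s1))" (is "?L \<longleftrightarrow> ?R")
    if "1 \<le> j" "j \<le> n" for j
  proof
    assume L: ?L
    show ?R
    proof (cases "m2 \<le> s2 \<and> j < s2")
      case True
      then have "s2 \<in> {m2..s2}" by simp
      note * = bspec[OF L this]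
      show ?thesis
        using bspec[OF *, of j] bspec[OF *, of "j + 1"] bspec[OF *, of s2] that True bounds by simp
    qed auto
  qed auto
  \<comment> \<open>Dually, the binding \<open>k\<close> is the left end \<open>l1\<close>, tested
    at \<open>z = j\<close>, \<open>z = l1\<close> and \<open>z = j - 1\<close>.\<close>
  have across_down: "(\<forall>k\<in>{l1..r1}. \<forall>z\<in>{1..n}. (k < z \<and> z \<le> j \<longrightarrow> l1 \<le> z \<and> z \<le> r1) \<and> (k \<le> z \<and> z < j \<longrightarrow> l2 \<le> z \<and> z \<le> r2)) \<longleftrightarrow>
     (j < l1 \<or> r1 < l1 \<or> j \<le> r1 \<and> (l1 < j \<longrightarrow> l2 \<le> l1 \<and> j \<le> r2 + 1))" (is "?L \<longleftrightarrow> ?R")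
    if "1 \<le> j" "j \<le> n" for j
  proof
    assume L: ?L
    show ?R
    proof (cases "l1 \<le> r1 \<and> l1 < j")
      case True
      then have "l1 \<in> {l1..r1}" by simp
      note * = bspec[OF L this]
      have "j \<le> r1" using bspec[OF *, of j] that True by simp
      moreover have "l2 \<le> l1" using bspec[OF *, of l1] that True bounds by simp
      moreover have "j - 1 \<in> {1..n}" "l1 \<le> j - 1" "j - 1 < j" using that True bounds by auto
      then have "j - 1 \<le> r2" using bspec[OF *, of "j - 1"] by blast
      ultimately show ?thesis by auto
    qed auto
  qed auto
  fix x assume "x \<in> two_by n"
  then consider j where "x = (1, j)" "1 \<le> j" "j \<le> n" | j where "x = (2, j)" "1 \<le> j" "j \<le> n"
    by (auto simp: two_by_def numeral_2_eq_2 le_Suc_eq)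
  then show "x \<in> rows m1 s1 m2 s2 \<longleftrightarrow>
      (if x \<in> rows l1 r1 l2 r2 then (\<exists>u\<in>rows l1 r1 l2 r2. u < x) \<and> (\<exists>v\<in>rows m1 s1 m2 s2. x < v)
       else (\<forall>v\<in>rows m1 s1 m2 s2. \<forall>z\<in>two_by n. x < z \<and> z < v \<longrightarrow> z \<in> rows m1 s1 m2 s2) \<and>
         (\<forall>u\<in>rows l1 r1 l2 r2. \<forall>z\<in>two_by n. u < z \<and> z < x \<longrightarrow> z \<in> rows l1 r1 l2 r2))"
  proof cases
    case 1
    have "(\<exists>u\<in>rows l1 r1 l2 r2. u < x) \<longleftrightarrow> l1 \<le> r1 \<and> l1 < j"
      "(\<exists>v\<in>rows m1 s1 m2 s2. x < v) \<longleftrightarrow> j < s1 \<and> m1 \<le> s1 \<or> j \<le> s2 \<and> m2 \<le> s2"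
      unfolding 1 bex_rows less_pair_iff by (auto simp: quant simp del: atLeastAtMost_iff bex_simps)
    moreover have "(\<forall>v\<in>rows m1 s1 m2 s2. \<forall>z\<in>two_by n. x < z \<and> z < v \<longrightarrow> z \<in> rows m1 s1 m2 s2) \<longleftrightarrow>
        (s1 \<le> j \<or> m1 \<le> j + 1 \<or> s1 < m1) \<and> (s2 < j \<or> s2 < m2 \<or> m2 \<le> j \<and> (j < s2 \<longrightarrow> m1 \<le> j + 1 \<and> s2 \<le> s1))"
      unfolding 1 ball_rows ball_two_by less_pair_iff mem_rows
        across_up[OF 1(2,3), symmetric] between(1)[OF 1(2,3) bounds(6,5), symmetric]
      by (simp add: ball_conj_distrib del: atLeastAtMost_iff)
    moreover have "(\<forall>u\<in>rows l1 r1 l2 r2. \<forall>z\<in>two_by n. u < z \<and> z < x \<longrightarrow> z \<in> rows l1 r1 l2 r2) \<longleftrightarrow>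
        j \<le> l1 \<or> j \<le> r1 + 1 \<or> r1 < l1"
      unfolding 1 ball_rows ball_two_by less_pair_iff mem_rows
        between(2)[OF 1(2,3) bounds(2,1), symmetric]
      by (simp del: atLeastAtMost_iff)
    ultimately show ?thesis
      using row1[OF 1(2,3)] unfolding 1 mem_rows by (simp del: not_le) argo
  next
    case 2
    have "(\<exists>u\<in>rows l1 r1 l2 r2. u < x) \<longleftrightarrow> l1 \<le> r1 \<and> l1 \<le> j \<or> l2 \<le> r2 \<and> l2 < j"
      "(\<exists>v\<in>rows m1 s1 m2 s2. x < v) \<longleftrightarrow> j < s2 \<and> m2 \<le> s2"
      unfolding 2 bex_rows less_pair_iff by (auto simp: quant simp del: atLeastAtMost_iff bex_simps)
    moreover have "(\<forall>v\<in>rows m1 s1 m2 s2. \<forall>z\<in>two_by n. x < z \<and> z < v \<longrightarrow> z \<in> rows m1 s1 m2 s2) \<longleftrightarrow>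
        s2 \<le> j \<or> m2 \<le> j + 1 \<or> s2 < m2"
      unfolding 2 ball_rows ball_two_by less_pair_iff mem_rows
        between(1)[OF 2(2,3) bounds(8,7), symmetric]
      by (simp del: atLeastAtMost_iff)
    moreover have "(\<forall>u\<in>rows l1 r1 l2 r2. \<forall>z\<in>two_by n. u < z \<and> z < x \<longrightarrow> z \<in> rows l1 r1 l2 r2) \<longleftrightarrow>
        (j \<le> l2 \<or> j \<le> r2 + 1 \<or> r2 < l2) \<and> (j < l1 \<or> r1 < l1 \<or> j \<le> r1 \<and> (l1 < j \<longrightarrow> l2 \<le> l1 \<and> j \<le> r2 + 1))"
      unfolding 2 ball_rows ball_two_by less_pair_iff mem_rows
        across_down[OF 2(2,3), symmetric] between(2)[OF 2(2,3) bounds(4,3), symmetric]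
      by (simp add: ball_conj_distrib conj_commute del: atLeastAtMost_iff)
    ultimately show ?thesis
      using row2[OF 2(2,3)] unfolding 2 mem_rows by (simp del: not_le) argo
  qed
qed

text \<open>The two parts of each name give the move of row 2, which is toggled first, and that of row 1.\<close>

context
  fixes n xs l1 r1 l2 r2
  assumes xs: "linear_extension (two_by n) xs"
    and I: "interval_closed (two_by n) (rows l1 r1 l2 r2)"
    and pos: "1 \<le> l1" "1 \<le> l2"
begin

lemma rowmotion_shift_shift:
  assumes "r2 < r1" "l2 < l1" "r1 < n" "l1 \<le> r1" "l2 \<le> r2"
  shows "rowmotion (two_by n) xs (rows l1 r1 l2 r2) = rows (l1 + 1) (r1 + 1) (l2 + 1) (r2 + 1)"
  by (rule rowmotion_rowsI[OF xs I]) (use pos assms in auto)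

text \<open>At the wall, elements of row 1 survive only below the new row 2, so row 1 is cut at
  \<open>r2 + 1\<close>. For \<open>l1 = r2 + 1\<close> it becomes empty.\<close>

lemma rowmotion_shift_overlap:
  assumes "r1 = n" "l2 < l1" "l1 \<le> r2 + 1" "r2 < n" "l1 \<le> r1" "l2 \<le> r2"
  shows "rowmotion (two_by n) xs (rows l1 r1 l2 r2) = rows (l1 + 1) (r2 + 1) (l2 + 1) (r2 + 1)"
  by (rule rowmotion_rowsI[OF xs I]) (use pos assms in auto)

text \<open>At the wall nothing above supports row 1, so it vanishes and the columns to its left
  fill. They fill only from \<open>l2 + 1\<close> on: \<open>(2, l2)\<close> has just left and would
  be missing between a lower \<open>(1, j)\<close> and row 2. For \<open>l1 = r2 + 2\<close> the
  rows become equal.\<close>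

lemma rowmotion_shift_apart:
  assumes "r1 = n" "r2 + 1 < l1" "l1 \<le> r1" "l2 \<le> r2"
  shows "rowmotion (two_by n) xs (rows l1 r1 l2 r2) = rows (l2 + 1) (l1 - 1) (l2 + 1) (r2 + 1)"
  by (rule rowmotion_rowsI[OF xs I]) (use pos assms in auto)

lemma rowmotion_wrap_wrap:
  assumes "r1 = n" "r2 = n" "l2 \<le> l1" "l2 \<le> n" "l1 \<le> n + 1"
  shows "rowmotion (two_by n) xs (rows l1 r1 l2 r2) = rows 1 (l1 - 1) 1 (l2 - 1)"
  by (rule rowmotion_rowsI[OF xs I]) (use pos assms in auto)

text \<open>Here \<open>(2, r2 + 1)\<close> cannot enter, as \<open>(1, r2 + 1)\<close> is missing
  below it. So nothing holds row 2 from above, and it is replaced by the columns to its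
  left.\<close>

lemma rowmotion_wrap_shift:
  assumes "r1 = r2" "r2 < n" "l2 \<le> l1" "l1 \<le> r1"
  shows "rowmotion (two_by n) xs (rows l1 r1 l2 r2) = rows (l1 + 1) (r1 + 1) 1 (l2 - 1)"
  by (rule rowmotion_rowsI[OF xs I]) (use pos assms in auto)

text \<open>If row 2 is nonempty, \<open>(2, l2)\<close> stays, having \<open>(1, l1)\<close> below
  it and \<open>(2, r2 + 1)\<close> above, and all columns to its left join row 2. The case
  \<open>l2 = r2 + 1\<close> is an empty row 2.\<close>

lemma rowmotion_extend_shift:
  assumes "l1 = l2" "l2 \<le> r2 + 1" "r2 < r1" "r1 < n"
  shows "rowmotion (two_by n) xs (rows l1 r1 l2 r2) = rows (l1 + 1) (r1 + 1) 1 (r2 + 1)"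
  by (rule rowmotion_rowsI[OF xs I]) (use pos assms in auto)

lemma rowmotion_extend_overlap:
  assumes "l1 = l2" "l2 \<le> r2 + 1" "r2 < r1" "r1 = n"
  shows "rowmotion (two_by n) xs (rows l1 r1 l2 r2) = rows (l1 + 1) (r2 + 1) 1 (r2 + 1)"
  by (rule rowmotion_rowsI[OF xs I]) (use pos assms in auto)

end

section \<open>Injectivity of the encoding and signed cardinality from endpoints\<close>

lemma rows_eq_iff:
  "rows l1 r1 l2 r2 = rows l1' r1' l2' r2' \<longleftrightarrow> {l1..r1} = {l1'..r1'} \<and> {l2..r2} = {l2'..r2'}"
proof
  assume eq: "rows l1 r1 l2 r2 = rows l1' r1' l2' r2'"
  have "{l1..r1} = {j. (1, j) \<in> rows l1 r1 l2 r2}" "{l2..r2} = {j. (2, j) \<in> rows l1 r1 l2 r2}"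
    for l1 r1 l2 r2
    by (auto simp: mem_rows)
  then show "{l1..r1} = {l1'..r1'} \<and> {l2..r2} = {l2'..r2'}" using eq by metis
qed (simp add: rows_def del: Icc_eq_Icc)

lemma two_row_set_eq_rows: "two_row_set b1 i1 a1 b2 i2 a2 = rows (b1 + 1) (b1 + i1) (b2 + 1) (b2 + i2)"
  by (auto simp: two_row_set_def rows_def)

text \<open>For an empty interval with \<open>l = r + 1\<close> the two end signs cancel, so the
  formula covers the encodings of empty rows too.\<close>

lemma alternating_sum_interval:
  fixes l r :: nat
  assumes "l \<le> r + 1"
  shows "2 * (\<Sum>j=l..r. (- 1) ^ j) = ((- 1) ^ l + (- 1) ^ r :: int)"
  using assms
proof (induction r)
  case 0
  then show ?case by (cases "l = 0") (auto simp: le_Suc_eq)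
next
  case (Suc r)
  then show ?case by (cases "l = r + 2") (auto simp: algebra_simps)
qed

lemma signed_card_rows:
  assumes "1 \<le> l1" "l1 \<le> r1 + 1" "l2 \<le> r2 + 1"
  shows "2 * signed_card (rows l1 r1 l2 r2) = (- 1) ^ l2 + (- 1) ^ r2 - (- 1) ^ l1 - (- 1) ^ r1"
proof -
  have "signed_card (rows l1 r1 l2 r2) =
      (\<Sum>x\<in>{1} \<times> {l1..r1}. (- 1) ^ grid_rank x) + (\<Sum>x\<in>{2} \<times> {l2..r2}. (- 1) ^ grid_rank x)"
    unfolding signed_card_def rows_def by (rule sum.union_disjoint) auto
  also have "(\<Sum>x\<in>{1} \<times> {l1..r1}. (- 1) ^ grid_rank x) = (\<Sum>j=l1..r1. (- 1) ^ (1 + j - 2) :: int)"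
    unfolding sum.cartesian_product' by (simp add: grid_rank_def)
  also have "\<dots> = - (\<Sum>j=l1..r1. (- 1) ^ j)"
    unfolding sum_negf[symmetric]
  proof (rule sum.cong)
    fix j assume "j \<in> {l1..r1}"
    \<comment> \<open>The subtraction in \<open>1 + j - 2\<close> is truncated: at
      \<open>j = 0\<close> the sign would be wrong, which \<open>1 <= l1\<close> rules out.\<close>
    then obtain i where "j = Suc i" using assms(1) by (cases j) auto
    then show "(- 1) ^ (1 + j - 2) = (- ((- 1) ^ j) :: int)" by simp
  qed simp
  also have "(\<Sum>x\<in>{2} \<times> {l2..r2}. (- 1) ^ grid_rank x) = (\<Sum>j=l2..r2. (- 1) ^ j :: int)"
    unfolding sum.cartesian_product' by (simp add: grid_rank_def)
  finally show ?thesis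
    using alternating_sum_interval[OF assms(2)] alternating_sum_interval[OF assms(3)] by simp
qed

section \<open>Invariant families of endpoint data and their orbit sums\<close>

text \<open>The borderline values are chosen for invariance. With \<open>2 <= l2\<close>, row 2
  refills to a nonempty \<open>1..l2 - 1\<close>; \<open>r1 < n\<close> in the last shape avoids
  reaching equal right ends with \<open>l2 = 1\<close>; a gap \<open>l1 = r2 + 2\<close> would lead
  to equal rows, and \<open>l1 = r2 + 1\<close> to an empty row 1.\<close>

definition generic :: "nat \<Rightarrow> (nat \<times> nat \<times> nat \<times> nat) set" where
  "generic n = {(l1, r1, l2, r2). 1 \<le> l2 \<and> 1 \<le> l1 \<and> l1 \<le> r1 \<and> l2 \<le> r2 \<and> r1 \<le> n \<and>
     (l2 < l1 \<and> l1 \<le> r2 \<and> r2 < r1 \<or> 2 \<le> l2 \<and> l2 < l1 \<and> r1 = r2 \<or>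
      r2 + 3 \<le> l1 \<or> l1 = l2 \<and> r2 < r1 \<and> r1 < n)}"

text \<open>Equal rows with \<open>b\<close> columns before, \<open>i\<close> inside and
  \<open>a\<close> after become, \<open>a + 1\<close> steps later, equal rows with these numbers
  rotated to \<open>a\<close>, \<open>b\<close>, \<open>i\<close>. In between, row 1 starts two
  columns after the end of row 2.\<close>

definition double :: "nat \<Rightarrow> (nat \<times> nat \<times> nat \<times> nat) set" where
  "double n = {(l1, r1, l2, r2). 1 \<le> l2 \<and> 1 \<le> l1 \<and> l1 \<le> r1 \<and> l2 \<le> r2 \<and> r1 \<le> n \<and>
     (1 < l1 \<and> l1 = l2 \<and> r1 = r2 \<and> r2 < n \<or> l1 = r2 + 2)}"

context
  fixes n xs \<O>
  assumes n: "odd n"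
    and xs: "linear_extension (two_by n) xs"
    and orb: "rowmotion_orbit (two_by n) xs \<O>"
begin

text \<open>Telescoping is applied to the doubled signed cardinality, so that \<open>K\<close> stays
  integral and \<open>step\<close> becomes an identity between endpoint signs.\<close>

lemma sum_signed_card_eq_0I:
  fixes K :: "nat \<times> nat \<times> nat \<times> nat \<Rightarrow> int"
  defines "enc \<equiv> \<lambda>(l1, r1, l2, r2). rows l1 r1 l2 r2"
  assumes "inj_on enc T" "t \<in> T" "enc t \<in> \<O>"
    and bounds: "\<And>l1 r1 l2 r2. (l1, r1, l2, r2) \<in> T \<Longrightarrow> 1 \<le> l1 \<and> l1 \<le> r1 + 1 \<and> l2 \<le> r2 + 1"
    and step: "\<And>l1 r1 l2 r2. (l1, r1, l2, r2) \<in> T \<Longrightarrow> interval_closed (two_by n) (rows l1 r1 l2 r2) \<Longrightarrow>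
      \<exists>m1 s1 m2 s2. (m1, s1, m2, s2) \<in> T \<and>
        rowmotion (two_by n) xs (rows l1 r1 l2 r2) = rows m1 s1 m2 s2 \<and>
        (- 1) ^ l2 + (- 1) ^ r2 - (- 1) ^ l1 - (- 1) ^ r1 + (- 1) ^ m2 + (- 1) ^ s2 - (- 1) ^ m1 - (- 1) ^ s1
          = K (m1, s1, m2, s2) - K (l1, r1, l2, r2)"
  shows "(\<Sum>I\<in>\<O>. signed_card I) = 0"
proof -
  have cyc: "cyclic_on (rowmotion (two_by n) xs) \<O>" and ics: "\<And>I. I \<in> \<O> \<Longrightarrow> interval_closed (two_by n) I"
    using orb by (auto simp: rowmotion_orbit_def)
  have "(\<Sum>I\<in>\<O>. 2 * signed_card I) = 0"
  proof (rule orbit_sum_eq_0[OF cyc assms(2,3,4)])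
    fix t assume t: "t \<in> T" "enc t \<in> \<O>"
    obtain l1 r1 l2 r2 where [simp]: "t = (l1, r1, l2, r2)" by (cases t) auto
    from t have T: "(l1, r1, l2, r2) \<in> T" and I: "interval_closed (two_by n) (rows l1 r1 l2 r2)"
      using ics by (auto simp: enc_def)
    obtain m1 s1 m2 s2 where m: "(m1, s1, m2, s2) \<in> T"
      "rowmotion (two_by n) xs (rows l1 r1 l2 r2) = rows m1 s1 m2 s2"
      "(- 1) ^ l2 + (- 1) ^ r2 - (- 1) ^ l1 - (- 1) ^ r1 + (- 1) ^ m2 + (- 1) ^ s2 - (- 1) ^ m1 - (- 1) ^ s1
          = K (m1, s1, m2, s2) - K (l1, r1, l2, r2)"
      using step[OF T I] by blast
    have "2 * signed_card (enc t) + 2 * signed_card (enc (m1, s1, m2, s2)) = K (m1, s1, m2, s2) - K t"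
      using bounds[OF T] bounds[OF m(1)] m(3) by (simp add: enc_def signed_card_rows)
    then show "\<exists>t'\<in>T. rowmotion (two_by n) xs (enc t) = enc t' \<and>
        2 * signed_card (enc t) + 2 * signed_card (enc t') = K t' - K t"
      using m(1,2) by (intro bexI[of _ "(m1, s1, m2, s2)"]) (auto simp: enc_def)
  qed
  then show ?thesis by (simp flip: sum_distrib_left)
qed


lemma sum_generic:
  assumes start: "(l1, r1, l2, r2) \<in> generic n" "rows l1 r1 l2 r2 \<in> \<O>"
  shows "(\<Sum>I\<in>\<O>. signed_card I) = 0"
proof -
  \<comment> \<open>Shifts contribute nothing, so \<open>K\<close> is 0 on \<open>nested\<close> and
    \<open>apart\<close>. On the other two shapes it is the sign defect of the wall step leading
    there: \<open>e r2 - e n\<close> into \<open>aligned\<close> from \<open>nested\<close>,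
    \<open>e l2 - e n\<close> into \<open>left\<close> from \<open>apart\<close>, with
    \<open>e n = -1\<close>.\<close>
  define K :: "nat \<times> nat \<times> nat \<times> nat \<Rightarrow> int" where
    "K = (\<lambda>(l1, r1, l2, r2). if r1 = r2 then 1 - (- 1) ^ r1 else if l1 = l2 then 1 - (- 1) ^ l1 else 0)"
  show ?thesis
  proof (rule sum_signed_card_eq_0I[where T = "generic n" and t = "(l1, r1, l2, r2)" and K = K])
    show "inj_on (\<lambda>(l1, r1, l2, r2). rows l1 r1 l2 r2) (generic n)"
      by (auto simp: inj_on_def generic_def rows_eq_iff Icc_eq_Icc)
  next
    fix l1 r1 l2 r2
    assume T: "(l1, r1, l2, r2) \<in> generic n" and I: "interval_closed (two_by n) (rows l1 r1 l2 r2)"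
    have pos: "1 \<le> l1" "1 \<le> l2" and bd: "l1 \<le> r1" "l2 \<le> r2" "r1 \<le> n"
      and shape: "l2 < l1 \<and> l1 \<le> r2 \<and> r2 < r1 \<or> 2 \<le> l2 \<and> l2 < l1 \<and> r1 = r2 \<or>
        r2 + 3 \<le> l1 \<or> l1 = l2 \<and> r2 < r1 \<and> r1 < n"
      using T unfolding generic_def by simp_all
    from shape consider (nested) "l2 < l1" "l1 \<le> r2" "r2 < r1" | (aligned) "2 \<le> l2" "l2 < l1" "r1 = r2"
      | (apart) "r2 + 3 \<le> l1" | (left) "l1 = l2" "r2 < r1" "r1 < n"
      by blast
    then show "\<exists>m1 s1 m2 s2. (m1, s1, m2, s2) \<in> generic n \<and>
        rowmotion (two_by n) xs (rows l1 r1 l2 r2) = rows m1 s1 m2 s2 \<and>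
        (- 1) ^ l2 + (- 1) ^ r2 - (- 1) ^ l1 - (- 1) ^ r1 + (- 1) ^ m2 + (- 1) ^ s2 - (- 1) ^ m1 - (- 1) ^ s1
          = K (m1, s1, m2, s2) - K (l1, r1, l2, r2)"
    \<comment> \<open>Away from shifts, \<open>nested\<close> turns into \<open>aligned\<close> at
      the wall, \<open>aligned\<close> into \<open>apart\<close> or, at the wall, into
      \<open>left\<close>, \<open>apart\<close> into \<open>left\<close> at the wall, and
      \<open>left\<close> into \<open>nested\<close>.\<close>
    proof cases
      case nested
      show ?thesis
      proof (cases "r1 < n")
        case True
        with nested have "rowmotion (two_by n) xs (rows l1 r1 l2 r2) = rows (l1 + 1) (r1 + 1) (l2 + 1) (r2 + 1)"
          using bd by (intro rowmotion_shift_shift[OF xs I pos])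
        moreover have "(l1 + 1, r1 + 1, l2 + 1, r2 + 1) \<in> generic n"
          using nested True bd by (simp add: generic_def)
        ultimately show ?thesis
          using nested by (intro exI conjI) (assumption+, simp add: K_def)
      next
        case False
        then have "r1 = n" using bd by simp
        with nested have "rowmotion (two_by n) xs (rows l1 r1 l2 r2) = rows (l1 + 1) (r2 + 1) (l2 + 1) (r2 + 1)"
          using bd by (intro rowmotion_shift_overlap[OF xs I pos]) simp_all
        moreover have "(l1 + 1, r2 + 1, l2 + 1, r2 + 1) \<in> generic n"
          using nested \<open>r1 = n\<close> bd pos by (simp add: generic_def)
        ultimately show ?thesis
          using nested \<open>r1 = n\<close> n by (intro exI conjI) (assumption+, simp add: K_def)
      qed
    next
      case aligned
      show ?thesis
      proof (cases "r1 < n")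
        case True
        with aligned have "rowmotion (two_by n) xs (rows l1 r1 l2 r2) = rows (l1 + 1) (r1 + 1) 1 (l2 - 1)"
          using bd by (intro rowmotion_wrap_shift[OF xs I pos]) simp_all
        moreover have "(l1 + 1, r1 + 1, 1, l2 - 1) \<in> generic n"
          using aligned True bd unfolding generic_def by auto
        ultimately show ?thesis
          using aligned bd by (intro exI conjI) (assumption+, auto simp: K_def minus_one_power_iff)
      next
        case False
        then have "r1 = n" using bd by simp
        with aligned have "rowmotion (two_by n) xs (rows l1 r1 l2 r2) = rows 1 (l1 - 1) 1 (l2 - 1)"
          using bd by (intro rowmotion_wrap_wrap[OF xs I pos]) simp_all
        moreover have "(1, l1 - 1, 1, l2 - 1) \<in> generic n"
          using aligned \<open>r1 = n\<close> bd unfolding generic_def by auto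
        ultimately show ?thesis
          using aligned \<open>r1 = n\<close> n by (intro exI conjI) (assumption+, auto simp: K_def minus_one_power_iff)
      qed
    next
      case apart
      then have "l2 < l1" "r2 < r1" "l1 \<noteq> l2" "r1 \<noteq> r2" using bd by simp_all
      show ?thesis
      proof (cases "r1 < n")
        case True
        with apart have "rowmotion (two_by n) xs (rows l1 r1 l2 r2) = rows (l1 + 1) (r1 + 1) (l2 + 1) (r2 + 1)"
          using bd by (intro rowmotion_shift_shift[OF xs I pos]) simp_all
        moreover have "(l1 + 1, r1 + 1, l2 + 1, r2 + 1) \<in> generic n"
          using apart True bd by (simp add: generic_def)
        ultimately show ?thesis
          using \<open>l1 \<noteq> l2\<close> \<open>r1 \<noteq> r2\<close> by (intro exI conjI) (assumption+, simp add: K_def)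
      next
        case False
        then have "r1 = n" using bd by simp
        with apart have "rowmotion (two_by n) xs (rows l1 r1 l2 r2) = rows (l2 + 1) (l1 - 1) (l2 + 1) (r2 + 1)"
          using bd by (intro rowmotion_shift_apart[OF xs I pos]) simp_all
        moreover have "(l2 + 1, l1 - 1, l2 + 1, r2 + 1) \<in> generic n"
          using apart \<open>r1 = n\<close> bd pos unfolding generic_def by auto
        moreover have "(- 1) ^ (l1 - 1) = - ((- 1) ^ l1 :: int)"
          using pos by (cases l1) auto
        ultimately show ?thesis
          using apart \<open>l1 \<noteq> l2\<close> \<open>r1 \<noteq> r2\<close> \<open>r1 = n\<close> n
          by (intro exI conjI) (assumption+, auto simp: K_def)
      qed
    next
      case left
      then have "rowmotion (two_by n) xs (rows l1 r1 l2 r2) = rows (l1 + 1) (r1 + 1) 1 (r2 + 1)"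
        using bd by (intro rowmotion_extend_shift[OF xs I pos]) simp_all
      moreover have "(l1 + 1, r1 + 1, 1, r2 + 1) \<in> generic n"
        using left bd pos by (simp add: generic_def)
      ultimately show ?thesis
        using left pos by (intro exI conjI) (assumption+, simp add: K_def)
    qed
  qed (use start in \<open>auto simp: generic_def\<close>)
qed

lemma sum_double:
  assumes start: "(l1, r1, l2, r2) \<in> double n" "rows l1 r1 l2 r2 \<in> \<O>"
  shows "(\<Sum>I\<in>\<O>. signed_card I) = 0"
proof -
  \<comment> \<open>A shift raises \<open>r1 + l2\<close> by 2, so \<open>K\<close> is constant
    while row 1 travels to the wall.\<close>
  define K :: "nat \<times> nat \<times> nat \<times> nat \<Rightarrow> int" where
    "K = (\<lambda>(l1, r1, l2, r2). if r1 = r2 then 1 else (- 1) ^ (r1 + l2))"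
  show ?thesis
  proof (rule sum_signed_card_eq_0I[where T = "double n" and t = "(l1, r1, l2, r2)" and K = K])
    show "inj_on (\<lambda>(l1, r1, l2, r2). rows l1 r1 l2 r2) (double n)"
      by (auto simp: inj_on_def double_def rows_eq_iff Icc_eq_Icc)
  next
    fix l1 r1 l2 r2
    assume T: "(l1, r1, l2, r2) \<in> double n" and I: "interval_closed (two_by n) (rows l1 r1 l2 r2)"
    have pos: "1 \<le> l1" "1 \<le> l2" and bd: "l1 \<le> r1" "l2 \<le> r2" "r1 \<le> n"
      and shape: "1 < l1 \<and> l1 = l2 \<and> r1 = r2 \<and> r2 < n \<or> l1 = r2 + 2"
      using T unfolding double_def by auto
    from shape bd consider "1 < l1" "l1 = l2" "r1 = r2" "r2 < n" | "l1 = r2 + 2" "r1 < n" | "l1 = r2 + 2" "r1 = n"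
      by force
    then show "\<exists>m1 s1 m2 s2. (m1, s1, m2, s2) \<in> double n \<and>
        rowmotion (two_by n) xs (rows l1 r1 l2 r2) = rows m1 s1 m2 s2 \<and>
        (- 1) ^ l2 + (- 1) ^ r2 - (- 1) ^ l1 - (- 1) ^ r1 + (- 1) ^ m2 + (- 1) ^ s2 - (- 1) ^ m1 - (- 1) ^ s1
          = K (m1, s1, m2, s2) - K (l1, r1, l2, r2)"
    proof cases
      case 1
      with bd have "rowmotion (two_by n) xs (rows l1 r1 l2 r2) = rows (l1 + 1) (r1 + 1) 1 (l2 - 1)"
        by (intro rowmotion_wrap_shift[OF xs I pos]) auto
      with 1 bd show ?thesis
        by (intro exI conjI) (auto simp: double_def K_def minus_one_power_iff)
    next
      case 2
      with bd have "rowmotion (two_by n) xs (rows l1 r1 l2 r2) = rows (l1 + 1) (r1 + 1) (l2 + 1) (r2 + 1)"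
        by (intro rowmotion_shift_shift[OF xs I pos]) auto
      with 2 bd show ?thesis
        by (intro exI conjI) (auto simp: double_def K_def)
    next
      case 3
      with bd have "rowmotion (two_by n) xs (rows l1 r1 l2 r2) = rows (l2 + 1) (l1 - 1) (l2 + 1) (r2 + 1)"
        by (intro rowmotion_shift_apart[OF xs I pos]) auto
      with 3 bd pos n show ?thesis
        by (intro exI conjI) (auto simp: double_def K_def minus_one_power_iff)
    qed
  qed (use start in \<open>auto simp: double_def\<close>)
qed

lemma sum_corner:
  assumes "3 \<le> n" and start: "rows 1 1 1 0 \<in> \<O>"
  shows "(\<Sum>I\<in>\<O>. signed_card I) = 0"
proof -
  \<comment> \<open>The orbit of \<open>{(1, 1)}\<close>: one element per row moves along the grid,
    then come \<open>{(2, n)}\<close>, its complement, and the complement of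
    \<open>{(1, 1)}\<close>.\<close>
  define T where "T = {(l1, r1, l2, r2). l1 = 1 \<and> r1 = 1 \<and> l2 = 1 \<and> r2 = 0 \<or>
    l1 = n + 1 \<and> r1 = n \<and> l2 = n \<and> r2 = n \<or> l1 = 1 \<and> r1 = n \<and> l2 = 1 \<and> r2 = n - 1 \<or>
    l1 = 2 \<and> r1 = n \<and> l2 = 1 \<and> r2 = n \<or>
    2 \<le> l1 \<and> l1 \<le> n \<and> r1 = l1 \<and> l2 = l1 - 1 \<and> r2 = l1 - 1}"
  \<comment> \<open>An empty interval does not determine its endpoints. Injectivity survives because
    each row is empty in only one state.\<close>
  have empty1: "(l1, r1, l2, r2) = (n + 1, n, n, n)" if "(l1, r1, l2, r2) \<in> T" "\<not> l1 \<le> r1" for l1 r1 l2 r2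
    using that \<open>3 \<le> n\<close> unfolding T_def by auto
  have empty2: "(l1, r1, l2, r2) = (1, 1, 1, 0)" if "(l1, r1, l2, r2) \<in> T" "\<not> l2 \<le> r2" for l1 r1 l2 r2
    using that \<open>3 \<le> n\<close> unfolding T_def by auto
  \<comment> \<open>Only the steps onto and off the run of states with one element per row fail to
    cancel; their doubled sums are -2 and, as \<open>n\<close> is odd, +2.\<close>
  define K :: "nat \<times> nat \<times> nat \<times> nat \<Rightarrow> int" where
    "K = (\<lambda>(l1, r1, l2, r2). if l1 = r1 \<and> l2 = r2 then - 2 else 0)"
  show ?thesis
  proof (rule sum_signed_card_eq_0I[where T = T and t = "(1, 1, 1, 0)" and K = K])
    show "inj_on (\<lambda>(l1, r1, l2, r2). rows l1 r1 l2 r2) T"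
    proof (rule inj_onI)
      fix t t' assume tT: "t \<in> T" "t' \<in> T"
        and eq: "(case t of (l1, r1, l2, r2) \<Rightarrow> rows l1 r1 l2 r2) = (case t' of (l1, r1, l2, r2) \<Rightarrow> rows l1 r1 l2 r2)"
      obtain l1 r1 l2 r2 m1 s1 m2 s2 where t: "t = (l1, r1, l2, r2)" "t' = (m1, s1, m2, s2)"
        by (cases t; cases t') auto
      have T: "(l1, r1, l2, r2) \<in> T" "(m1, s1, m2, s2) \<in> T" using tT t by simp_all
      from eq have rows_eq: "l1 = m1 \<and> r1 = s1 \<or> \<not> l1 \<le> r1 \<and> \<not> m1 \<le> s1"
        "l2 = m2 \<and> r2 = s2 \<or> \<not> l2 \<le> r2 \<and> \<not> m2 \<le> s2"
        by (simp_all add: t rows_eq_iff Icc_eq_Icc)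
      consider "l1 \<le> r1" "l2 \<le> r2" | "\<not> l1 \<le> r1" | "\<not> l2 \<le> r2" by blast
      then show "t = t'"
      proof cases
        case 1
        with rows_eq show ?thesis by (simp add: t)
      next
        case 2
        with rows_eq have "\<not> m1 \<le> s1" by blast
        then show ?thesis using empty1[OF T(1) 2] empty1[OF T(2)] t by metis
      next
        case 3
        with rows_eq have "\<not> m2 \<le> s2" by blast
        then show ?thesis using empty2[OF T(1) 3] empty2[OF T(2)] t by metis
      qed
    qed
  next
    fix l1 r1 l2 r2
    assume T: "(l1, r1, l2, r2) \<in> T" and I: "interval_closed (two_by n) (rows l1 r1 l2 r2)"
    from T consider (1) "l1 = 1" "r1 = 1" "l2 = 1" "r2 = 0" | (2) "l1 = n + 1" "r1 = n" "l2 = n" "r2 = n"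
      | (3) "l1 = 1" "r1 = n" "l2 = 1" "r2 = n - 1" | (4) "l1 = 2" "r1 = n" "l2 = 1" "r2 = n"
      | (5) "2 \<le> l1" "l1 \<le> n" "r1 = l1" "l2 = l1 - 1" "r2 = l1 - 1"
      unfolding T_def by blast
    note shapes = this
    have pos: "1 \<le> l1" "1 \<le> l2" using \<open>3 \<le> n\<close> by (cases rule: shapes; simp)+
    show "\<exists>m1 s1 m2 s2. (m1, s1, m2, s2) \<in> T \<and>
        rowmotion (two_by n) xs (rows l1 r1 l2 r2) = rows m1 s1 m2 s2 \<and>
        (- 1) ^ l2 + (- 1) ^ r2 - (- 1) ^ l1 - (- 1) ^ r1 + (- 1) ^ m2 + (- 1) ^ s2 - (- 1) ^ m1 - (- 1) ^ s1
          = K (m1, s1, m2, s2) - K (l1, r1, l2, r2)"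
    proof (cases rule: shapes)
      case 1
      with \<open>3 \<le> n\<close> have "rowmotion (two_by n) xs (rows l1 r1 l2 r2) = rows 2 2 1 1"
        using rowmotion_extend_shift[OF xs I pos] by (simp add: numeral_2_eq_2)
      with 1 \<open>3 \<le> n\<close> show ?thesis
        by (intro exI conjI) (auto simp: T_def K_def)
    next
      case 2
      with \<open>3 \<le> n\<close> have "rowmotion (two_by n) xs (rows l1 r1 l2 r2) = rows 1 n 1 (n - 1)"
        using rowmotion_wrap_wrap[OF xs I pos] by simp
      with 2 n \<open>3 \<le> n\<close> show ?thesis
        by (intro exI conjI) (auto simp: T_def K_def)
    next
      case 3
      with \<open>3 \<le> n\<close> have "rowmotion (two_by n) xs (rows l1 r1 l2 r2) = rows 2 n 1 n"
        using rowmotion_extend_overlap[OF xs I pos] by (simp add: numeral_2_eq_2)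
      with 3 n \<open>3 \<le> n\<close> show ?thesis
        by (intro exI conjI) (auto simp: T_def K_def)
    next
      case 4
      with \<open>3 \<le> n\<close> have "rowmotion (two_by n) xs (rows l1 r1 l2 r2) = rows 1 1 1 0"
        using rowmotion_wrap_wrap[OF xs I pos] by simp
      with 4 n \<open>3 \<le> n\<close> show ?thesis
        by (intro exI conjI) (auto simp: T_def K_def)
    next
      case 5
      show ?thesis
      proof (cases "l1 < n")
        case True
        with 5 have "rowmotion (two_by n) xs (rows l1 r1 l2 r2) = rows (l1 + 1) (l1 + 1) l1 l1"
          using rowmotion_shift_shift[OF xs I pos] by simp
        moreover have "(l1 + 1, l1 + 1, l1, l1) \<in> T"
          using 5 True unfolding T_def by simp
        moreover have "(- 1) ^ (l1 - 1) = - ((- 1) ^ l1 :: int)"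
          using pos by (cases l1) auto
        ultimately show ?thesis
          using 5 by (intro exI conjI) (assumption+, simp add: K_def)
      next
        case False
        then have "l1 = n" using 5 by simp
        with 5 \<open>3 \<le> n\<close> have "rowmotion (two_by n) xs (rows l1 r1 l2 r2) = rows (n + 1) n n n"
          using rowmotion_shift_overlap[OF xs I pos] by simp
        moreover have "(n + 1, n, n, n) \<in> T"
          unfolding T_def by simp
        ultimately show ?thesis
          using 5 \<open>l1 = n\<close> n by (intro exI conjI) (assumption+, simp add: K_def)
      qed
    qed
  qed (use start \<open>3 \<le> n\<close> in \<open>auto simp: T_def\<close>)
qed

end

section \<open>The four families of starting sets\<close>

theorem theorem3p10:
  fixes n :: nat and xs :: "(nat \<times> nat) list" and \<O> :: "(nat \<times> nat) set set"
  assumes "odd n"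
    and "linear_extension (two_by n) xs"
    and "rowmotion_orbit (two_by n) xs \<O>"
    and "card \<O> = n + 3"
    and "(\<exists>r. 1 \<le> r \<and> real r \<le> real n / 2 \<and>
              two_row_set 0 r (n - r) 0 (r - 1) (n + 1 - r) \<in> \<O>)
       \<or> (\<exists>a i b. a > 0 \<and> i > 0 \<and> b > 0 \<and> a + i + b = n \<and>
              \<not> (a = i \<and> i = b \<and> real b = real n / 3) \<and>
              two_row_set b i a b i a \<in> \<O>)
       \<or> (\<exists>b i t. b + i = n \<and> i \<ge> 1 \<and> t \<ge> 2 \<and> b - t \<ge> 1 \<and>
              two_row_set b i 0 (b - t) (t + i) 0 \<in> \<O>)
       \<or> (\<exists>a b j k. a + b + j + k = n \<and> j \<ge> 2 \<and> b \<ge> 2 \<and> k \<ge> 1 \<and> a \<ge> 0 \<and>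
              (j \<noteq> b \<or> a + 1 \<noteq> k) \<and>
              two_row_set b (k + j) a 0 (b + k) (a + j) \<in> \<O>)"
  shows "average_signed_card \<O> = 0"
proof -
  note orbit = assms(1-3)
  have "(\<Sum>I\<in>\<O>. signed_card I) = 0"
    using assms(5)
  proof (elim disjE, goal_cases)
    case 1
    then obtain r where r: "1 \<le> r" "real r \<le> real n / 2" "two_row_set 0 r (n - r) 0 (r - 1) (n + 1 - r) \<in> \<O>"
      by blast
    then have O: "rows 1 r 1 (r - 1) \<in> \<O>" by (simp add: two_row_set_eq_rows)
    have "2 * r \<le> n" using r(2) by linarith
    show ?thesis
    \<comment> \<open>For \<open>r = 1\<close> row 2 is empty, which \<open>generic\<close>
      excludes; for \<open>r >= 2\<close> the set has the shape with \<open>l1 = l2\<close>.\<close>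
    proof (cases "r = 1")
      case True
      then have "3 \<le> n" using \<open>2 * r \<le> n\<close> \<open>odd n\<close> by presburger
      with True O show ?thesis using sum_corner[OF orbit] by simp
    next
      case False
      with r(1) \<open>2 * r \<le> n\<close> show ?thesis
        by (intro sum_generic[OF orbit _ O]) (auto simp: generic_def)
    qed
  next
    case 2
    then obtain a i b where "a > 0" "i > 0" "b > 0" "a + i + b = n" "two_row_set b i a b i a \<in> \<O>"
      by blast
    then show ?thesis
      by (intro sum_double[OF orbit, of "b + 1" "b + i" "b + 1" "b + i"])
        (auto simp: double_def two_row_set_eq_rows)
  next
    case 3
    then obtain b i t where "b + i = n" "i \<ge> 1" "t \<ge> 2" "b - t \<ge> 1" "two_row_set b i 0 (b - t) (t + i) 0 \<in> \<O>"
      by blast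
    then show ?thesis
      \<comment> \<open>Since \<open>b - t >= 1\<close>, the subtraction is exact: both rows end at
        \<open>n\<close>, and row 2 starts at column 2 or later.\<close>
      by (intro sum_generic[OF orbit, of "b + 1" "b + i" "b - t + 1" "b - t + (t + i)"])
        (auto simp: generic_def two_row_set_eq_rows)
  next
    case 4
    then obtain a b j k where "a + b + j + k = n" "j \<ge> 2" "b \<ge> 2" "k \<ge> 1"
      "two_row_set b (k + j) a 0 (b + k) (a + j) \<in> \<O>"
      by blast
    then show ?thesis
      by (intro sum_generic[OF orbit, of "b + 1" "b + (k + j)" 1 "b + k"])
        (auto simp: generic_def two_row_set_eq_rows)
  qed
  then show ?thesis
    unfolding average_signed_card_def by (simp flip: of_int_sum)
qed

end
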